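(* Let $r$ and $m$ be positive integers. If there is a strong Schur partition of the integer interval $[1, m] = \{1, 2, \dots, m\}$ into $r$ subsets, then there is a weak Schur partition of $[1, 4m+2]$ into $r+1$ subsets, and there is a weak Schur partition of $[1, 13m+8]$ into $r+2$ subsets.
   Context: A partition of $[1, n]$ into $r$ disjoint non-empty subsets $S_1, \dots, S_r$ is a strong Schur partition if no subset $S_i$ contains integers $a, b, c$ (not necessarily distinct) with $a + b = c$, i.e. each subset is sum-free. It is a weak Schur partition if no subset $S_i$ contains three distinct integers $a, b, c$ with $a + b = c$ (each subset is weakly sum-free). *)

theory Defs
  imports Main "HOL-Library.Disjoint_Sets"
begin

definition sum_free :: "nat set \<Rightarrow> bool" where
  "sum_free S \<longleftrightarrow> \<not> (\<exists>a\<in>S. \<exists>b\<in>S. \<exists>c\<in>S. a + b = c)"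

definition weakly_sum_free :: "nat set \<Rightarrow> bool" where
  "weakly_sum_free S \<longleftrightarrow>
    \<not> (\<exists>a\<in>S. \<exists>b\<in>S. \<exists>c\<in>S. a \<noteq> b \<and> a \<noteq> c \<and> b \<noteq> c \<and> a + b = c)"

(* partition_on requires the blocks to be pairwise disjoint and non-empty, so the
   number r of blocks of the partition is the cardinality of P. *)

definition strong_Schur_partition :: "nat \<Rightarrow> nat \<Rightarrow> nat set set \<Rightarrow> bool" where
  "strong_Schur_partition n r P \<longleftrightarrow>
    partition_on {1..n} P \<and> card P = r \<and> (\<forall>S\<in>P. sum_free S)"

definition weak_Schur_partition :: "nat \<Rightarrow> nat \<Rightarrow> nat set set \<Rightarrow> bool" where
  "weak_Schur_partition n r P \<longleftrightarrow>
    partition_on {1..n} P \<and> card P = r \<and> (\<forall>S\<in>P. weakly_sum_free S)"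

end

theory Submission
  imports Defs
begin

text \<open>
  Let w = 3d + 1. Every integer within distance d of a positive multiple wj inherits the colour
  of j: offsets are at most d in absolute value, so an equation a + b = c forces the same
  equation between the multiples. What remains of [1, wm + 2d] is [1, d] together with the
  integers whose residue mod w lies in [d + 1, 2d], and this interval of residues is sum-free
  mod w. Hence a weak Schur partition of [1, 2d], repeated with period w on its upper half
  only, colours the remainder. The two bounds are the cases d = 1 with {1,2}, and d = 4 with
  {1,2,4,8}, {3,5,6,7}.
\<close>

definition inflate :: "nat \<Rightarrow> nat set \<Rightarrow> nat set" where
  "inflate d S = {x. (x + d) mod (3 * d + 1) \<le> 2 * d \<and> (x + d) div (3 * d + 1) \<in> S}"

text \<open>The disjunct \<open>x \<le> d\<close> retains the lower half of \<open>T\<close> in the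
  first period only.\<close>

definition lift_upper :: "nat \<Rightarrow> nat \<Rightarrow> nat set \<Rightarrow> nat set" where
  "lift_upper d n T =
    {x \<in> {1..n}. x mod (3 * d + 1) \<in> T \<and> (x \<le> d \<or> d < x mod (3 * d + 1))}"

section \<open>Sum-freeness of the lifted blocks\<close>

text \<open>Distinct multiples of \<open>w\<close> are at least \<open>w\<close> apart. The
  remainders \<open>s\<close> and \<open>t\<close> may exceed \<open>w\<close>, as happens for sums
  of residues; only their difference is bounded.\<close>

lemma mult_add_eq_imp_eq:
  fixes w p q s t :: nat
  assumes "w * p + s = w * q + t" "s < t + w" "t < s + w"
  shows "p = q"
proof (rule ccontr)
  assume "p \<noteq> q"
  then consider "Suc p \<le> q" | "Suc q \<le> p" by linarith
  then show False
  proof cases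
    case 1
    then have "w * Suc p \<le> w * q" by (rule mult_le_mono2)
    with assms show False by simp
  next
    case 2
    then have "w * Suc q \<le> w * p" by (rule mult_le_mono2)
    with assms show False by simp
  qed
qed

lemma sum_free_inflate:
  assumes "sum_free S"
  shows "sum_free (inflate d S)"
  unfolding sum_free_def
proof (intro notI, elim bexE)
  fix a b c
  assume mem: "a \<in> inflate d S" "b \<in> inflate d S" "c \<in> inflate d S" and abc: "a + b = c"
  let ?w = "3 * d + 1"
  define i j k where ijk: "i = (a + d) div ?w" "j = (b + d) div ?w" "k = (c + d) div ?w"
  define e f g where efg: "e = (a + d) mod ?w" "f = (b + d) mod ?w" "g = (c + d) mod ?w"
  have dec: "?w * i + e = a + d" "?w * j + f = b + d" "?w * k + g = c + d"
    unfolding ijk efg by (rule mult_div_mod_eq)+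
  \<comment> \<open>Both summands carry a shift \<open>d\<close> but \<open>c\<close> only one,
    hence the extra \<open>d\<close> on the right. With remainders at most \<open>2 * d\<close>, the
    two sides' offsets differ by at most \<open>3 * d\<close>, just below \<open>?w\<close>.\<close>
  have "?w * (i + j) + (e + f) = ?w * k + (g + d)"
    unfolding distrib_left using dec abc by linarith
  moreover have "e \<le> 2 * d" "f \<le> 2 * d" "g \<le> 2 * d"
    using mem by (auto simp: inflate_def efg)
  ultimately have "i + j = k"
    by (intro mult_add_eq_imp_eq[of ?w "i + j" "e + f" k "g + d"]) linarith+
  moreover have "i \<in> S" "j \<in> S" "k \<in> S"
    using mem by (auto simp: inflate_def ijk)
  ultimately show False
    using assms by (auto simp: sum_free_def)
qed

lemma weakly_sum_free_lift_upper:
  assumes T: "T \<subseteq> {1..2 * d}" and "weakly_sum_free T"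
  shows "weakly_sum_free (lift_upper d n T)"
  unfolding weakly_sum_free_def
proof (intro notI, elim bexE conjE)
  fix a b c
  assume mem: "a \<in> lift_upper d n T" "b \<in> lift_upper d n T" "c \<in> lift_upper d n T"
    and abc: "a + b = c" and "a \<noteq> b"
  let ?w = "3 * d + 1"
  \<comment> \<open>If a summand is at most \<open>d\<close>, reduction mod \<open>?w\<close>
    produces no carry and yields an equation inside \<open>T\<close> itself.\<close>
  have no_small: False
    if uv: "u \<in> lift_upper d n T" "v \<in> lift_upper d n T" "u + v = c" "u \<noteq> v" "u \<le> d" for u v
  proof -
    define y j z k where yz: "y = v mod ?w" "j = v div ?w" "z = c mod ?w" "k = c div ?w"
    have dec: "?w * j + y = v" "?w * k + z = c"
      unfolding yz by (rule mult_div_mod_eq)+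
    have in_T: "u \<in> T" "y \<in> T" "z \<in> T"
      using uv mem by (auto simp: lift_upper_def yz)
    then have bounds: "1 \<le> u" "1 \<le> y" "1 \<le> z" "y \<le> 2 * d" "z \<le> 2 * d"
      using T by auto
    have eq: "?w * j + (u + y) = ?w * k + z"
      using dec uv by linarith
    then have "j = k"
      using bounds uv by (intro mult_add_eq_imp_eq[of ?w j "u + y" k z]) linarith+
    with eq have "u + y = z" by simp
    \<comment> \<open>Weak sum-freeness of \<open>T\<close> needs distinct summands. A later copy
      \<open>v\<close> of \<open>u\<close> would spoil this, but beyond \<open>d\<close> only
      residues above \<open>d\<close> occur.\<close>
    moreover have "u \<noteq> y"
    proof (cases "v \<le> d")
      case True
      then show ?thesis using uv by (simp add: yz)
    next
      case False
      then show ?thesis using uv by (auto simp: lift_upper_def yz)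
    qed
    ultimately show False
      using assms in_T bounds by (auto simp: weakly_sum_free_def)
  qed
  have "d < a"
    using no_small[of a b] mem abc \<open>a \<noteq> b\<close> by (meson not_le)
  moreover have "d < b"
    using no_small[of b a] mem abc \<open>a \<noteq> b\<close> by (metis add.commute not_le)
  ultimately have "d < c" using abc by simp
  define x i y j z k where xyz: "x = a mod ?w" "i = a div ?w" "y = b mod ?w" "j = b div ?w"
    "z = c mod ?w" "k = c div ?w"
  have dec: "?w * i + x = a" "?w * j + y = b" "?w * k + z = c"
    unfolding xyz by (rule mult_div_mod_eq)+
  have "x \<in> T" "y \<in> T" "z \<in> T"
    using mem by (auto simp: lift_upper_def xyz)
  then have le: "x \<le> 2 * d" "y \<le> 2 * d" "z \<le> 2 * d"
    using T by auto
  have gt: "d < x" "d < y" "d < z"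
    using mem \<open>d < a\<close> \<open>d < b\<close> \<open>d < c\<close> by (auto simp: lift_upper_def xyz)
  have eq: "?w * (i + j) + (x + y) = ?w * k + z"
    unfolding distrib_left using dec abc by linarith
  \<comment> \<open>Equal multiples would force \<open>x + y = z\<close>, yet
    \<open>x + y > 2 * d\<close> while \<open>z \<le> 2 * d\<close>.\<close>
  then have "i + j = k"
    using le gt by (intro mult_add_eq_imp_eq[of ?w "i + j" "x + y" k z]) linarith+
  with eq le gt show False by simp
qed

section \<open>Assembling the partition\<close>

lemma card_Un_image_disjoint:
  assumes "finite P" "finite T" "inj_on f P" "inj_on g T" "f ` P \<inter> g ` T = {}"
  shows "card (f ` P \<union> g ` T) = card P + card T"
  using assms by (simp add: card_Un_disjoint card_image)

lemma weak_Schur_partition_inflate: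
  assumes P: "strong_Schur_partition m r P" and T: "weak_Schur_partition (2 * d) k T"
  shows "\<exists>Q. weak_Schur_partition ((3 * d + 1) * m + 2 * d) (r + k) Q"
proof -
  let ?w = "3 * d + 1"
  let ?n = "?w * m + 2 * d"
  let ?I = "inflate d" and ?L = "lift_upper d ?n"
  have partP: "partition_on {1..m} P" and partT: "partition_on {1..2 * d} T"
    using P T by (auto simp: strong_Schur_partition_def weak_Schur_partition_def)
  have S_sub: "S \<subseteq> {1..m}" "S \<noteq> {}" if "S \<in> P" for S
    using that partP by (auto simp: partition_on_def)
  have R_sub: "R \<subseteq> {1..2 * d}" "R \<noteq> {}" if "R \<in> T" for R
    using that partT by (auto simp: partition_on_def)
  \<comment> \<open>The exact multiples of \<open>?w\<close> recover \<open>S\<close> from its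
    inflation, which gives non-emptiness and injectivity; \<open>low\<close> does the same for
    \<open>?L\<close>.\<close>
  have multiple: "?w * j \<in> ?I S \<longleftrightarrow> j \<in> S" for j S
  proof -
    have "(d + ?w * j) div ?w = j + d div ?w" by (rule div_mult_self2) simp
    moreover have "(d + ?w * j) mod ?w = d mod ?w" by (rule mod_mult_self2)
    moreover have "d div ?w = 0" "d mod ?w = d" by simp_all
    ultimately have "(d + ?w * j) div ?w = j" "(d + ?w * j) mod ?w = d" by linarith+
    then show ?thesis by (simp add: inflate_def add.commute)
  qed
  have low: "x \<in> ?L R \<longleftrightarrow> x \<in> R" if "x \<in> {1..2 * d}" for x R
    using that by (auto simp: lift_upper_def)
  \<comment> \<open>The shift by \<open>d\<close> moves the residues \<open>[d + 1, 2d]\<close> to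
    \<open>[2d + 1, 3d]\<close>, exactly those that \<open>inflate\<close> rejects.\<close>
  have upper: "d < x mod ?w \<and> x mod ?w \<le> 2 * d \<longleftrightarrow> 2 * d < (x + d) mod ?w" for x
  proof -
    define y where "y = x mod ?w"
    have "y < ?w" unfolding y_def by simp
    have shift: "(x + d) mod ?w = (y + d) mod ?w"
      unfolding y_def by (rule mod_add_left_eq[symmetric])
    have "d < y \<and> y \<le> 2 * d \<longleftrightarrow> 2 * d < (y + d) mod ?w"
    proof (cases "y + d < ?w")
      case True
      then have "(y + d) mod ?w = y + d" by (rule mod_less)
      with True show ?thesis by linarith
    next
      case False
      moreover have "y + d - ?w < ?w" using \<open>y < ?w\<close> by linarith
      ultimately have "(y + d) mod ?w = y + d - ?w"
        by (metis le_mod_geq mod_less not_less)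
      with False \<open>y < ?w\<close> show ?thesis by linarith
    qed
    then show ?thesis unfolding shift y_def[symmetric] .
  qed
  have small: "(x + d) div ?w = 0 \<longleftrightarrow> x \<le> 2 * d" for x
    by (simp add: div_eq_0_iff) linarith
  have I_range: "x \<in> {1..?n}" "d < x" if "S \<in> P" "x \<in> ?I S" for x S
  proof -
    have q: "1 \<le> (x + d) div ?w" "(x + d) div ?w \<le> m" and e: "(x + d) mod ?w \<le> 2 * d"
      using that S_sub[of S] by (auto simp: inflate_def)
    have "\<not> x \<le> 2 * d" using small[of x] q by linarith
    moreover have "?w * ((x + d) div ?w) \<le> ?w * m" using q by (intro mult_le_mono2)
    ultimately show "x \<in> {1..?n}" "d < x"
      using e mult_div_mod_eq[of ?w "x + d"] by auto
  qed
  have I_L_disj: "?I S \<inter> ?L R = {}" if "S \<in> P" "R \<in> T" for S R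
  proof -
    have False if x: "x \<in> ?I S" "x \<in> ?L R" for x
    proof -
      have "x mod ?w \<in> R" "d < x mod ?w"
        using x I_range(2)[OF \<open>S \<in> P\<close> x(1)] by (auto simp: lift_upper_def)
      then have "2 * d < (x + d) mod ?w"
        using upper[of x] R_sub[OF \<open>R \<in> T\<close>] by auto
      then show False using x by (simp add: inflate_def)
    qed
    then show ?thesis by blast
  qed
  have I_ne: "?I S \<noteq> {}" if "S \<in> P" for S
    using S_sub[OF that] multiple by blast
  have L_ne: "?L R \<noteq> {}" if "R \<in> T" for R
    using R_sub[OF that] low by (metis equals0D equals0I subsetD)
  have inj_I: "inj_on ?I P"
    by (rule inj_onI) (metis multiple subsetI subset_antisym)
  have inj_L: "inj_on ?L T"
  proof (rule inj_onI)
    fix R R' assume "R \<in> T" "R' \<in> T" "?L R = ?L R'"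
    then show "R = R'" using R_sub low by blast
  qed
  let ?Q = "?I ` P \<union> ?L ` T"
  have cover: "x \<in> \<Union> ?Q" if x: "x \<in> {1..?n}" for x
  proof (cases "2 * d < (x + d) mod ?w")
    case True
    then have "d < x mod ?w" "x mod ?w \<in> {1..2 * d}" using upper[of x] by auto
    then show ?thesis using x partT by (auto simp: partition_on_def lift_upper_def)
  next
    case False
    show ?thesis
    proof (cases "x \<le> d")
      case True
      then have "x \<in> \<Union> T" using x partT by (auto simp: partition_on_def)
      then show ?thesis using x True by (auto simp: lift_upper_def)
    next
      case not_small: False
      \<comment> \<open>This is tight: the largest \<open>x\<close> gives
        \<open>x + d = ?w * Suc m - 1\<close>, so the interval stops just before the neighbourhood
        of the next multiple.\<close>
      have "x + d < ?w * Suc m" using x by simp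
      then have "(x + d) div ?w \<le> m"
        by (metis less_Suc_eq_le less_mult_imp_div_less mult.commute)
      moreover have "(x + d) div ?w \<noteq> 0"
      proof
        assume "(x + d) div ?w = 0"
        then have "x + d < ?w" using small[of x] by linarith
        then show False using False not_small by simp
      qed
      ultimately have "(x + d) div ?w \<in> \<Union> P" using partP by (auto simp: partition_on_def)
      then show ?thesis using False by (auto simp: inflate_def)
    qed
  qed
  have "partition_on {1..?n} ?Q"
  proof (rule partition_onI)
    show "\<Union> ?Q = {1..?n}"
    proof (intro equalityI subsetI)
      fix x assume "x \<in> \<Union> ?Q"
      then show "x \<in> {1..?n}" using I_range(1) by (auto simp: lift_upper_def)
    qed (rule cover)
    have II: "disjnt (?I S) (?I S')" if "S \<in> P" "S' \<in> P" "S \<noteq> S'" for S S'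
      using disjointD[OF partition_onD2[OF partP] that] by (auto simp: disjnt_def inflate_def)
    have LL: "disjnt (?L R) (?L R')" if "R \<in> T" "R' \<in> T" "R \<noteq> R'" for R R'
      using disjointD[OF partition_onD2[OF partT] that] by (auto simp: disjnt_def lift_upper_def)
    have IL: "disjnt (?I S) (?L R)" "disjnt (?L R) (?I S)" if "S \<in> P" "R \<in> T" for S R
      using I_L_disj[OF that] by (auto simp: disjnt_def)
    show "disjnt A B" if "A \<in> ?Q" "B \<in> ?Q" "A \<noteq> B" for A B
      using that by (elim UnE imageE; hypsubst; intro II LL IL; auto)
    show "{} \<notin> ?Q" using I_ne L_ne by (metis UnE imageE)
  qed
  moreover have "card ?Q = r + k"
  proof -
    \<comment> \<open>A common member of the two families would be disjoint from itself, hence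
      empty.\<close>
    have "?I ` P \<inter> ?L ` T = {}" using I_L_disj I_ne by blast
    moreover have "finite P" "finite T"
      using partP partT finite_elements by blast+
    ultimately show ?thesis
      using P T card_Un_image_disjoint[OF _ _ inj_I inj_L]
      by (simp add: strong_Schur_partition_def weak_Schur_partition_def)
  qed
  moreover have "weakly_sum_free (?I S)" if "S \<in> P" for S
    using sum_free_inflate[of S d] that P
    by (auto simp: strong_Schur_partition_def sum_free_def weakly_sum_free_def)
  moreover have "weakly_sum_free (?L R)" if "R \<in> T" for R
    using weakly_sum_free_lift_upper[of R d] R_sub(1) that T
    by (auto simp: weak_Schur_partition_def)
  ultimately show ?thesis
    unfolding weak_Schur_partition_def by blast
qed

section \<open>Seed partitions and the two bounds\<close>

lemma weak_Schur_partition_2: "weak_Schur_partition 2 1 {{1, 2}}"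
  by (auto simp: weak_Schur_partition_def weakly_sum_free_def partition_on_def)

lemma weak_Schur_partition_8: "weak_Schur_partition 8 2 {{1, 2, 4, 8}, {3, 5, 6, 7}}"
proof -
  have "{1..8::nat} = {1, 2, 3, 4, 5, 6, 7, 8}" by auto
  moreover have "{1, 2, 4, 8} \<noteq> {3, 5, 6, 7::nat}" by auto
  ultimately show ?thesis
    by (auto simp: weak_Schur_partition_def weakly_sum_free_def partition_on_def disjoint_def)
qed

theorem theorem1:
  fixes r m :: nat
  assumes "r > 0" and "m > 0"
    and "\<exists>P. strong_Schur_partition m r P"
  shows "(\<exists>Q. weak_Schur_partition (4 * m + 2) (r + 1) Q) \<and>
         (\<exists>Q. weak_Schur_partition (13 * m + 8) (r + 2) Q)"
proof -
  obtain P where "strong_Schur_partition m r P" using assms(3) by blast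
  then show ?thesis
    using weak_Schur_partition_inflate[of m r P 1 1] weak_Schur_partition_2
      weak_Schur_partition_inflate[of m r P 4 2] weak_Schur_partition_8
    by auto
qed

end
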